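(* Let $\alpha$ be any positive real and let $r\geq 6$ be any integer. Let $A(\alpha,r)$ be an algorithm solving distance-constrained exploration for all instances of $\mathcal{I}(\alpha,r)$. Then for every integer $k>1$ there exists an instance $(G=(V,E),l_s,\alpha)$ of $\mathcal{I}(\alpha,r)$ such that $|V|\geq k$ and for which the penalty of $A$ is at least $$\left(\frac{|V|}{16\left(2\left\lfloor(1+\alpha)r\right\rfloor+3\right)}\right)^2 .$$
   Context: Model. A mobile agent explores a finite, simple, undirected, connected graph $G=(V,E)$ starting from a source node $s$. Nodes have pairwise distinct integer labels; at each node $v$ the incident edges carry distinct local port numbers $0,\dots,\deg(v)-1$, with no relation between the two ports of an edge. Initially the agent knows only the label and degree of $s$. It runs a deterministic algorithm: at each step the algorithm, based on everything memorized so far, chooses a port at the current node and the agent traverses the corresponding edge; on arrival it learns the label and degree of the new node and the incoming port number. The agent has unbounded memory. Exploration requires traversing every edge (hence visiting every node) at least once. Distance-constrained exploration: let $r$ be the eccentricity of $s$ in $G$ and $\alpha>0$ a real constant, and let $D=(1+\alpha)r$. At every moment the agent must know a path of length at most $D$ (i.e. a sequence of at most $D$ edges already traversed by the agent) from its current node to $s$. Both $\alpha$ and $r$ are given to the algorithm in advance. An instance is a tuple $(G,l_s,\alpha)$ where $l_s$ is the label of $s$; $\mathcal{I}(\alpha,r)$ denotes the set of all instances $(G,l_s,\alpha)$ in which the eccentricity of the node labeled $l_s$ is $r$. An algorithm $A(\alpha,r)$ solves the problem for all instances of $\mathcal{I}(\alpha,r)$ if on each such instance it explores the whole graph while always respecting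 the distance constraint, and terminates. The penalty of an algorithm on an instance with graph $G=(V,E)$ is the number of edge traversals it performs in excess of $|E|$. *)

theory Defs
  imports Complex_Main
begin

text \<open>Since node labels are pairwise distinct integers, a node is identified with its label.
  \<open>port G v u\<close> is the port number at \<open>v\<close> of the edge joining \<open>v\<close> and \<open>u\<close>; it is only
  meaningful when this edge exists.\<close>

record port_graph =
  verts :: "int set"
  edges :: "int set set"
  port :: "int \<Rightarrow> int \<Rightarrow> nat"

definition neighbours :: "port_graph \<Rightarrow> int \<Rightarrow> int set" where
  "neighbours G v = {u. {v, u} \<in> edges G}"

definition deg :: "port_graph \<Rightarrow> int \<Rightarrow> nat" where
  "deg G v = card (neighbours G v)"

text \<open>A walk is given by the list of its nodes, so its length is one less than the length of the
  list.\<close>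

definition walk_betw :: "int set set \<Rightarrow> int \<Rightarrow> int list \<Rightarrow> int \<Rightarrow> bool" where
  "walk_betw F u xs v \<longleftrightarrow>
     xs \<noteq> [] \<and> hd xs = u \<and> last xs = v \<and> successively (\<lambda>x y. {x, y} \<in> F) xs"

definition walk_length :: "int list \<Rightarrow> nat" where
  "walk_length xs = length xs - 1"

definition valid_graph :: "port_graph \<Rightarrow> bool" where
  "valid_graph G \<longleftrightarrow>
     finite (verts G) \<and>
     edges G \<subseteq> {{u, v} | u v. u \<in> verts G \<and> v \<in> verts G \<and> u \<noteq> v} \<and>
     (\<forall>u \<in> verts G. \<forall>v \<in> verts G. \<exists>xs. walk_betw (edges G) u xs v) \<and>
     (\<forall>v \<in> verts G. bij_betw (port G v) (neighbours G v) {..<deg G v})"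

definition distance :: "port_graph \<Rightarrow> int \<Rightarrow> int \<Rightarrow> nat" where
  "distance G u v = (LEAST n. \<exists>xs. walk_betw (edges G) u xs v \<and> walk_length xs = n)"

definition eccentricity :: "port_graph \<Rightarrow> int \<Rightarrow> nat" where
  "eccentricity G s = Max (distance G s ` verts G)"

definition instances :: "real \<Rightarrow> nat \<Rightarrow> (port_graph \<times> int \<times> real) set" where
  "instances \<alpha> r =
     {(G, s, \<alpha>) | G s. valid_graph G \<and> s \<in> verts G \<and> eccentricity G s = r}"

text \<open>One entry of a history records, for one edge traversal, the port by which the agent left, the
  port by which it arrived, and the label and degree of the node reached; entries are in
  chronological order. An algorithm receives the label and degree of the source together with the
  history so far, and returns the port to be taken next, or \<open>None\<close> in order to terminate.\<close>

type_synonym history = "(nat \<times> nat \<times> int \<times> nat) list"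

type_synonym algorithm = "int \<times> nat \<Rightarrow> history \<Rightarrow> nat option"

text \<open>\<open>execution A G s h v\<close>: running \<open>A\<close> on \<open>G\<close> from \<open>s\<close>, the agent at some moment has history \<open>h\<close>
  and is located at \<open>v\<close>. An execution choosing a port that does not exist at the current node is
  stuck without having terminated.\<close>

inductive execution :: "algorithm \<Rightarrow> port_graph \<Rightarrow> int \<Rightarrow> history \<Rightarrow> int \<Rightarrow> bool"
  for A G s where
  start: "execution A G s [] s"
| move: "execution A G s (h @ [(p, port G u v, u, deg G u)]) u"
    if "execution A G s h v" "A (s, deg G s) h = Some p" "u \<in> neighbours G v" "port G v u = p"

definition terminates_with :: "algorithm \<Rightarrow> port_graph \<Rightarrow> int \<Rightarrow> history \<Rightarrow> bool" where
  "terminates_with A G s h \<longleftrightarrow> (\<exists>v. execution A G s h v) \<and> A (s, deg G s) h = None"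

definition visited_nodes :: "int \<Rightarrow> history \<Rightarrow> int list" where
  "visited_nodes s h = s # map (\<lambda>(_, _, u, _). u) h"

definition traversed_edges :: "int \<Rightarrow> history \<Rightarrow> int set set" where
  "traversed_edges s h =
     {{visited_nodes s h ! i, visited_nodes s h ! Suc i} | i. i < length h}"

definition respects_distance :: "algorithm \<Rightarrow> port_graph \<Rightarrow> int \<Rightarrow> real \<Rightarrow> bool" where
  "respects_distance A G s D \<longleftrightarrow>
     (\<forall>h v. execution A G s h v \<longrightarrow>
        (\<exists>xs. walk_betw (traversed_edges s h) v xs s \<and> real (walk_length xs) \<le> D))"

definition explores :: "algorithm \<Rightarrow> port_graph \<Rightarrow> int \<Rightarrow> bool" where
  "explores A G s \<longleftrightarrow>
     (\<exists>h. terminates_with A G s h \<and> edges G \<subseteq> traversed_edges s h)"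

definition solves :: "algorithm \<Rightarrow> real \<Rightarrow> nat \<Rightarrow> bool" where
  "solves A \<alpha> r \<longleftrightarrow>
     (\<forall>G s. (G, s, \<alpha>) \<in> instances \<alpha> r \<longrightarrow>
        explores A G s \<and> respects_distance A G s ((1 + \<alpha>) * real r))"

text \<open>By \<open>terminates_with_unique\<close> below, the history at termination is unique if it exists.\<close>

definition traversals :: "algorithm \<Rightarrow> port_graph \<Rightarrow> int \<Rightarrow> nat" where
  "traversals A G s = length (THE h. terminates_with A G s h)"

definition penalty :: "algorithm \<Rightarrow> port_graph \<Rightarrow> int \<Rightarrow> int" where
  "penalty A G s = int (traversals A G s) - int (card (edges G))"

lemma execution_in_verts:
  assumes "valid_graph G" "s \<in> verts G" "execution A G s h v"
  shows "v \<in> verts G"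
  using assms(3)
proof induction
  case (move h v p u)
  then have "{v, u} \<in> edges G" by (simp add: neighbours_def)
  then obtain a b where "{v, u} = {a, b}" "a \<in> verts G" "b \<in> verts G"
    using assms(1) unfolding valid_graph_def by blast
  then show ?case by (metis doubleton_eq_iff)
qed (use assms in auto)

lemma execution_prefix:
  assumes "execution A G s h v" "n < length h"
  shows "\<exists>w. execution A G s (take n h) w \<and> A (s, deg G s) (take n h) \<noteq> None"
  using assms
proof induction
  case (move h v p u)
  then show ?case by (cases "n = length h") auto
qed simp

lemma execution_deterministic:
  assumes G: "valid_graph G" "s \<in> verts G"
    and "execution A G s h v" "execution A G s h' v'" "length h = length h'"
  shows "h = h' \<and> v = v'"
  using assms(3-)
proof (induction arbitrary: h' v' rule: execution.induct)
  case start
  then show ?case by (auto elim: execution.cases)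
next
  case (move h v p u)
  note IH = move.IH and mv = move.hyps and len = move.prems(2)
  from move.prems(1) show ?case
  proof (cases rule: execution.cases)
    case start
    then show ?thesis using len by simp
  next
    case (move g w q)
    have eq: "h = g" "v = w"
      using IH[OF move(2)] len move(1) by auto
    have "inj_on (port G v) (neighbours G v)"
      using G execution_in_verts[OF G mv(1)] by (auto simp: valid_graph_def bij_betw_def)
    then have "u = v'"
      using mv move eq by (auto dest: inj_onD)
    then show ?thesis
      using eq move mv by auto
  qed
qed

lemma terminates_with_unique:
  assumes G: "valid_graph G" "s \<in> verts G"
    and h: "terminates_with A G s h" and h': "terminates_with A G s h'"
  shows "h = h'"
proof -
  have not_less: "\<not> length g < length g'"
    if g: "terminates_with A G s g" and g': "terminates_with A G s g'" for g g'
  proof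
    assume less: "length g < length g'"
    obtain v v' where v: "execution A G s g v" "execution A G s g' v'"
      using g g' by (auto simp: terminates_with_def)
    obtain w where w: "execution A G s (take (length g) g') w"
      "A (s, deg G s) (take (length g) g') \<noteq> None"
      using execution_prefix[OF v(2) less] by blast
    have "g = take (length g) g'"
      using execution_deterministic[OF G v(1) w(1)] less by simp
    then show False
      using w(2) g by (simp add: terminates_with_def)
  qed
  have "length h = length h'"
    using not_less[OF h h'] not_less[OF h' h] by simp
  then show ?thesis
    using h h' execution_deterministic[OF G] by (auto simp: terminates_with_def)
qed

end

theory Submission
  imports Defs "HOL-Library.Nat_Bijection"
begin

text \<open>Let \<open>D = \<lfloor>(1 + \<alpha>) r\<rfloor>\<close>, and consider a chain of layers \<open>L\<^sub>0, \<dots>, L\<^sub>D\<^sub>+\<^sub>1\<close>, where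
  \<open>L\<^sub>0 = {s}\<close> and each of \<open>L\<^sub>1, \<dots>, L\<^sub>D\<^sub>+\<^sub>1\<close> has \<open>m\<close> nodes, with all edges between consecutive
  layers. The adversary fixes ports only when they are used, and lets a new port lead forward
  whenever the current node still has an untraversed forward edge. As long as every two consecutive
  layers other than \<open>L\<^sub>0, L\<^sub>1\<close> have an untraversed edge between them, one such edge per pair
  may turn out to be subdivided and linked to a hub, which brings every node within distance 6 of
  \<open>s\<close>; a path attached to the hub makes the eccentricity exactly \<open>r\<close>. So the agent always faces a
  possible instance, and since it knows no shortcut it can never enter \<open>L\<^sub>D\<^sub>+\<^sub>1\<close>.

  Each arrival at a node is followed by a departure, which uses a new forward edge, or an already
  traversed edge, or else a new backward edge when all forward edges at the node have been
  traversed. Hence the number of traversed backward edges at a node is at most the number of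
  traversed forward edges plus the number of departures along old edges, plus one if the agent is
  there. Summing over all layers from \<open>L\<^sub>i\<close> on telescopes: the number of traversed edges between
  \<open>L\<^sub>i\<^sub>-\<^sub>1\<close> and \<open>L\<^sub>i\<close> is at most one plus the penalty paid so far. Therefore the penalty is at least
  \<open>m\<^sup>2 - 2\<close> before the last of the \<open>m\<^sup>2\<close> edges between two layers is traversed.\<close>

section \<open>Sets of edges\<close>

definition adj :: "'a set set \<Rightarrow> 'a \<Rightarrow> 'a set" where
  "adj F x = {u. {x, u} \<in> F}"

lemma mem_adj_iff [simp]: "u \<in> adj F x \<longleftrightarrow> {x, u} \<in> F"
  by (simp add: adj_def)

lemma adj_mono: "F \<subseteq> F' \<Longrightarrow> adj F x \<subseteq> adj F' x"
  by auto

lemma adj_empty [simp]: "adj {} x = {}"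
  by auto

lemma adj_insert:
  "v \<noteq> u \<Longrightarrow> adj (insert {v, u} F) x =
     (if x = v then insert u (adj F v) else if x = u then insert v (adj F u) else adj F x)"
  by (auto simp: doubleton_eq_iff)

lemma neighbours_eq_adj: "neighbours G v = adj (edges G) v"
  by (auto simp: neighbours_def)

definition edges_between :: "'a set \<Rightarrow> 'a set \<Rightarrow> 'a set set" where
  "edges_between X Y = {{x, y} | x y. x \<in> X \<and> y \<in> Y}"

lemma edges_between_commute: "edges_between X Y = edges_between Y X"
  unfolding edges_between_def by (auto intro: insert_commute)

lemma edges_between_eq_image: "edges_between X Y = (\<lambda>(x, y). {x, y}) ` (X \<times> Y)"
  by (auto simp: edges_between_def)

lemma inj_on_doubleton: "X \<inter> Y = {} \<Longrightarrow> inj_on (\<lambda>(x, y). {x, y}) (X \<times> Y)"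
  by (auto simp: inj_on_def doubleton_eq_iff)

lemma card_edges_between:
  "X \<inter> Y = {} \<Longrightarrow> card (edges_between X Y) = card X * card Y"
  by (simp add: edges_between_eq_image card_image inj_on_doubleton card_cartesian_product)

lemma finite_edges_between: "\<lbrakk>finite X; finite Y\<rbrakk> \<Longrightarrow> finite (edges_between X Y)"
  by (simp add: edges_between_eq_image)

lemma sum_card_adj_between:
  assumes "finite X" "finite Y" "X \<inter> Y = {}"
  shows "(\<Sum>x\<in>X. card (adj F x \<inter> Y)) = card (F \<inter> edges_between X Y)"
proof -
  let ?S = "SIGMA x:X. adj F x \<inter> Y"
  have "(\<Sum>x\<in>X. card (adj F x \<inter> Y)) = card ?S"
    using assms by simp
  also have "\<dots> = card ((\<lambda>(x, y). {x, y}) ` ?S)"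
    by (rule card_image[symmetric], rule inj_on_subset[OF inj_on_doubleton[OF assms(3)]]) auto
  also have "(\<lambda>(x, y). {x, y}) ` ?S = F \<inter> edges_between X Y"
    by (auto simp: edges_between_def)
  finally show ?thesis .
qed

definition subdivision :: "'a set set \<Rightarrow> ('i \<Rightarrow> 'a set) \<Rightarrow> ('i \<Rightarrow> 'a) \<Rightarrow> 'i set \<Rightarrow> 'a set set" where
  "subdivision E e z I = E - e ` I \<union> {{x, z i} | x i. i \<in> I \<and> x \<in> e i}"

lemma card_adj_image:
  assumes "inj_on e I" and pairs: "\<And>i. i \<in> I \<Longrightarrow> card (e i) = 2"
  shows "card (adj (e ` I) x) = card {i \<in> I. x \<in> e i}"
proof -
  have "card (adj (e ` I) x) = card ((\<lambda>u. {x, u}) ` adj (e ` I) x)"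
    by (rule card_image[symmetric]) (auto simp: inj_on_def doubleton_eq_iff)
  also have "(\<lambda>u. {x, u}) ` adj (e ` I) x = e ` {i \<in> I. x \<in> e i}"
  proof (intro equalityI subsetI)
    fix f assume "f \<in> e ` {i \<in> I. x \<in> e i}"
    then obtain i where i: "i \<in> I" "x \<in> e i" "f = e i" by blast
    then obtain a b where "e i = {a, b}" using pairs[of i] by (auto simp: card_2_iff)
    then have "e i = {x, a} \<or> e i = {x, b}" using i(2) by auto
    then show "f \<in> (\<lambda>u. {x, u}) ` adj (e ` I) x" using i by force
  next
    fix f assume "f \<in> (\<lambda>u. {x, u}) ` adj (e ` I) x"
    then obtain u i where "i \<in> I" "f = e i" "f = {x, u}" by auto
    then show "f \<in> e ` {i \<in> I. x \<in> e i}" by auto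
  qed
  also have "card \<dots> = card {i \<in> I. x \<in> e i}"
    by (rule card_image, rule inj_on_subset[OF assms(1)]) auto
  finally show ?thesis .
qed

lemma card_adj_subdivision:
  assumes I: "e ` I \<subseteq> E" "inj_on e I" "inj_on z I"
    and pairs: "\<And>i. i \<in> I \<Longrightarrow> card (e i) = 2"
    and fresh: "z ` I \<inter> \<Union>E = {}" and x: "x \<notin> z ` I" and fin: "finite (adj E x)" "finite I"
  shows "card (adj (subdivision E e z I) x) = card (adj E x)"
proof -
  let ?J = "{i \<in> I. x \<in> e i}"
  have "{x, u} \<in> {{y, z i} | y i. i \<in> I \<and> y \<in> e i} \<longleftrightarrow> u \<in> z ` ?J" for u
    using x by (fastforce simp: doubleton_eq_iff)
  then have "adj (subdivision E e z I) x = (adj E x - adj (e ` I) x) \<union> z ` ?J"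
    unfolding subdivision_def adj_def by blast
  moreover have "(adj E x - adj (e ` I) x) \<inter> z ` ?J = {}"
    using fresh unfolding adj_def by blast
  ultimately have "card (adj (subdivision E e z I) x) =
      card (adj E x - adj (e ` I) x) + card (z ` ?J)"
    using fin by (simp add: card_Un_disjoint)
  moreover have sub: "adj (e ` I) x \<subseteq> adj E x"
    using I(1) by (rule adj_mono)
  moreover have "card (z ` ?J) = card (adj (e ` I) x)"
    using card_adj_image[OF I(2) pairs] card_image[OF inj_on_subset[OF I(3), of ?J]] by auto
  ultimately show ?thesis
    using card_Diff_subset[OF finite_subset[OF sub fin(1)] sub] card_mono[OF fin(1) sub] by simp
qed

section \<open>Walks and distances\<close>

lemma walk_betw_rev:
  assumes "walk_betw F a xs b"
  shows "walk_betw F b (rev xs) a"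
  using assms by (auto simp: walk_betw_def hd_rev last_rev insert_commute)

lemma walk_betw_trans:
  assumes "walk_betw F a xs b" "walk_betw F b ys c"
  shows "walk_betw F a (xs @ tl ys) c"
proof (cases ys)
  case Nil
  then show ?thesis using assms by (simp add: walk_betw_def)
next
  case (Cons z zs)
  then show ?thesis using assms
    by (cases zs) (auto simp: walk_betw_def successively_append_iff)
qed

lemma walk_betw_potential_le:
  fixes \<phi> :: "int \<Rightarrow> nat"
  assumes "walk_betw F a xs b" "\<And>x y. {x, y} \<in> F \<Longrightarrow> \<phi> y \<le> Suc (\<phi> x)"
  shows "\<phi> b \<le> \<phi> a + walk_length xs"
proof -
  have "xs \<noteq> [] \<Longrightarrow> successively (\<lambda>x y. {x, y} \<in> F) xs \<Longrightarrow>
    \<phi> (last xs) \<le> \<phi> (hd xs) + (length xs - 1)"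
  proof (induction xs)
    case (Cons x xs)
    then show ?case
      using assms(2)[of x "hd xs"] by (cases xs) auto
  qed simp
  then show ?thesis using assms(1) by (auto simp: walk_betw_def walk_length_def)
qed

definition walk_within :: "int set set \<Rightarrow> nat \<Rightarrow> int \<Rightarrow> int \<Rightarrow> bool" where
  "walk_within F n a b \<longleftrightarrow> (\<exists>xs. walk_betw F a xs b \<and> walk_length xs \<le> n)"

lemma walk_within_refl: "walk_within F 0 a a"
  unfolding walk_within_def walk_betw_def walk_length_def by (rule exI[of _ "[a]"]) simp

lemma walk_within_mono: "\<lbrakk>walk_within F m a b; m \<le> n\<rbrakk> \<Longrightarrow> walk_within F n a b"
  unfolding walk_within_def using order_trans by blast

lemma walk_within_step:
  assumes "walk_within F n a b" "{b, c} \<in> F"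
  shows "walk_within F (Suc n) a c"
proof -
  obtain xs where "walk_betw F a xs b" "walk_length xs \<le> n"
    using assms(1) by (auto simp: walk_within_def)
  then have "walk_betw F a (xs @ [c]) c" "walk_length (xs @ [c]) \<le> Suc n"
    using assms(2) by (auto simp: walk_betw_def walk_length_def successively_append_iff)
  then show ?thesis unfolding walk_within_def by blast
qed

lemma walk_within_edge: "{a, b} \<in> F \<Longrightarrow> walk_within F 1 a b"
  using walk_within_step[OF walk_within_refl] by simp

lemma distance_le:
  assumes "walk_within (edges G) n a b"
  shows "distance G a b \<le> n"
proof -
  obtain xs where xs: "walk_betw (edges G) a xs b" "walk_length xs \<le> n"
    using assms by (auto simp: walk_within_def)
  then have "distance G a b \<le> walk_length xs"
    unfolding distance_def by (intro Least_le) auto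
  with xs(2) show ?thesis by simp
qed

lemma potential_le_distance:
  fixes \<phi> :: "int \<Rightarrow> nat"
  assumes "walk_within (edges G) n a b" "\<And>x y. {x, y} \<in> edges G \<Longrightarrow> \<phi> y \<le> Suc (\<phi> x)"
  shows "\<phi> b \<le> \<phi> a + distance G a b"
proof -
  have "\<exists>ys. walk_betw (edges G) a ys b \<and> walk_length ys = distance G a b"
    unfolding distance_def
    by (rule LeastI_ex) (use assms(1) in \<open>auto simp: walk_within_def\<close>)
  then obtain ys where "walk_betw (edges G) a ys b" "walk_length ys = distance G a b" by blast
  then show ?thesis using walk_betw_potential_le[of "edges G" a ys b \<phi>] assms(2) by simp
qed

lemma eccentricity_eqI:
  fixes \<phi> :: "int \<Rightarrow> nat"
  assumes fin: "finite (verts G)"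
    and within: "\<And>v. v \<in> verts G \<Longrightarrow> walk_within (edges G) r s v"
    and step: "\<And>x y. {x, y} \<in> edges G \<Longrightarrow> \<phi> y \<le> Suc (\<phi> x)"
    and z: "z \<in> verts G" "\<phi> s + r \<le> \<phi> z"
  shows "eccentricity G s = r"
  unfolding eccentricity_def
proof (rule Max_eqI)
  have "r \<le> distance G s z"
    using potential_le_distance[OF within[OF z(1)], of \<phi>] step z(2) by force
  then have "distance G s z = r"
    using distance_le[OF within[OF z(1)]] by simp
  then show "r \<in> distance G s ` verts G" using z(1) by blast
qed (use fin within distance_le in auto)

lemma valid_graphI:
  assumes "finite (verts G)"
    and "edges G \<subseteq> {{u, v} | u v. u \<in> verts G \<and> v \<in> verts G \<and> u \<noteq> v}"
    and within: "\<And>v. v \<in> verts G \<Longrightarrow> walk_within (edges G) n s v"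
    and "\<And>v. bij_betw (port G v) (adj (edges G) v) {..<card (adj (edges G) v)}"
  shows "valid_graph G"
proof -
  have "\<exists>xs. walk_betw (edges G) u xs v" if uv: "u \<in> verts G" "v \<in> verts G" for u v
  proof -
    obtain xs ys where "walk_betw (edges G) s xs u" "walk_betw (edges G) s ys v"
      using within[OF uv(1)] within[OF uv(2)] unfolding walk_within_def by blast
    then show ?thesis using walk_betw_rev walk_betw_trans by blast
  qed
  then show ?thesis
    using assms by (simp add: valid_graph_def deg_def neighbours_eq_adj)
qed

section \<open>Partial port numberings\<close>

definition partial_ports :: "('a \<Rightarrow> nat) \<Rightarrow> 'a set set \<Rightarrow> ('a \<Rightarrow> 'a \<Rightarrow> nat) \<Rightarrow> bool" where
  "partial_ports d F P \<longleftrightarrow> (\<forall>x. inj_on (P x) (adj F x) \<and> P x ` adj F x \<subseteq> {..<d x})"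

lemma card_less_if_unused_port:
  assumes "partial_ports d F P" "p < d x" "p \<notin> P x ` adj F x"
  shows "card (adj F x) < d x"
proof -
  have "card (adj F x) = card (P x ` adj F x)"
    using assms(1) by (simp add: partial_ports_def card_image)
  also have "\<dots> < card {..<d x}"
    using assms by (intro psubset_card_mono) (auto simp: partial_ports_def)
  finally show ?thesis by simp
qed

lemma ex_unused_port:
  assumes "partial_ports d F P" "card (adj F x) < d x"
  shows "\<exists>q<d x. q \<notin> P x ` adj F x"
proof (rule ccontr)
  assume "\<not> ?thesis"
  then have "P x ` adj F x = {..<d x}"
    using assms(1) by (auto simp: partial_ports_def)
  then have "card (adj F x) = d x"
    using assms(1) by (metis card_image card_lessThan partial_ports_def)
  then show False using assms(2) by simp
qed

lemma partial_ports_insert: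
  assumes P: "partial_ports d F P" and vu: "v \<noteq> u" "{v, u} \<notin> F"
    and p: "p < d v" "p \<notin> P v ` adj F v" and u: "card (adj F u) < d u"
  obtains P' where "partial_ports d (insert {v, u} F) P'" "P' v u = p"
    "\<And>x y. {x, y} \<in> F \<Longrightarrow> P' x y = P x y"
proof -
  obtain q where q: "q < d u" "q \<notin> P u ` adj F u"
    using ex_unused_port[OF P u] by blast
  define P' where "P' = P(v := (P v)(u := p), u := (P u)(v := q))"
  have vu': "u \<notin> adj F v" "v \<notin> adj F u"
    using vu by (simp_all add: insert_commute)
  then have image: "P' v ` adj F v = P v ` adj F v" "P' u ` adj F u = P u ` adj F u"
    using vu(1) by (auto simp: P'_def)
  have inj: "inj_on (P' x) (adj F x)" for x
    using P p q by (auto simp: P'_def partial_ports_def intro: inj_on_fun_updI)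
  have "inj_on (P' x) (adj (insert {v, u} F) x) \<and>
      P' x ` adj (insert {v, u} F) x \<subseteq> {..<d x}" for x
    using P p q image vu vu' inj[of x]
    by (auto simp: adj_insert partial_ports_def P'_def)
  then have "partial_ports d (insert {v, u} F) P'"
    by (simp add: partial_ports_def)
  moreover have "P' v u = p" using vu(1) by (simp add: P'_def)
  moreover have "P' x y = P x y" if "{x, y} \<in> F" for x y
    using that vu(2) by (auto simp: P'_def insert_commute)
  ultimately show thesis by (rule that)
qed

lemma bij_betw_extend:
  fixes f :: "'a \<Rightarrow> nat"
  assumes "finite B" "A \<subseteq> B" "inj_on f A" "f ` A \<subseteq> {..<card B}"
  shows "\<exists>g. bij_betw g B {..<card B} \<and> (\<forall>x\<in>A. g x = f x)"
proof -
  have "finite A" using assms finite_subset by blast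
  then have "card (B - A) = card ({..<card B} - f ` A)"
    using assms by (simp add: card_Diff_subset card_image)
  then obtain k where k: "bij_betw k (B - A) ({..<card B} - f ` A)"
    using assms(1) by (metis finite_Diff finite_lessThan finite_same_card_bij)
  define g where "g x = (if x \<in> A then f x else k x)" for x
  have "bij_betw g A (f ` A)" "bij_betw g (B - A) ({..<card B} - f ` A)"
    using assms(3) k by (auto simp: g_def bij_betw_def inj_on_def)
  then have "bij_betw g (A \<union> (B - A)) (f ` A \<union> ({..<card B} - f ` A))"
    by (rule bij_betw_combine) auto
  moreover have "A \<union> (B - A) = B" "f ` A \<union> ({..<card B} - f ` A) = {..<card B}"
    using assms by auto
  ultimately show ?thesis by (auto simp: g_def)
qed

lemma partial_ports_extend:
  assumes "partial_ports (\<lambda>x. card (adj E x)) F P" "F \<subseteq> E" "\<And>x. finite (adj E x)"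
  obtains Q where "\<And>x. bij_betw (Q x) (adj E x) {..<card (adj E x)}"
    "\<And>x y. {x, y} \<in> F \<Longrightarrow> Q x y = P x y"
proof -
  have "\<exists>g. bij_betw g (adj E x) {..<card (adj E x)} \<and> (\<forall>y\<in>adj F x. g y = P x y)" for x
    by (rule bij_betw_extend) (use assms adj_mono in \<open>auto simp: partial_ports_def\<close>)
  then obtain Q where "\<And>x. bij_betw (Q x) (adj E x) {..<card (adj E x)} \<and>
      (\<forall>y\<in>adj F x. Q x y = P x y)"
    by metis
  then show thesis by (intro that[of Q]) auto
qed

section \<open>Histories and executions\<close>

definition position :: "int \<Rightarrow> history \<Rightarrow> int" where
  "position s h = last (visited_nodes s h)"

lemma position_Nil [simp]: "position s [] = s"
  by (simp add: position_def visited_nodes_def)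

lemma position_snoc [simp]: "position s (h @ [(p, q, u, d)]) = u"
  by (simp add: position_def visited_nodes_def)

lemma visited_nodes_snoc [simp]: "visited_nodes s (h @ [(p, q, u, d)]) = visited_nodes s h @ [u]"
  by (simp add: visited_nodes_def)

lemma position_in_visited_nodes: "position s h \<in> set (visited_nodes s h)"
  unfolding position_def by (rule last_in_set) (simp add: visited_nodes_def)

lemma traversed_edges_Nil [simp]: "traversed_edges s [] = {}"
  by (simp add: traversed_edges_def)

lemma traversed_edges_eq_image:
  "traversed_edges s h =
     (\<lambda>i. {visited_nodes s h ! i, visited_nodes s h ! Suc i}) ` {..<length h}"
  by (auto simp: traversed_edges_def)

lemma finite_traversed_edges [simp]: "finite (traversed_edges s h)"
  by (simp add: traversed_edges_eq_image)

lemma traversed_edges_snoc [simp]: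
  "traversed_edges s (h @ [(p, q, u, d)]) = insert {position s h, u} (traversed_edges s h)"
proof -
  have len: "length (visited_nodes s h) = Suc (length h)" by (simp add: visited_nodes_def)
  then have "position s h = visited_nodes s h ! length h"
    by (metis position_def diff_Suc_1 last_conv_nth length_0_conv nat.distinct(1))
  then show ?thesis
    by (simp add: traversed_edges_eq_image lessThan_Suc nth_append len)
qed

lemma card_traversed_edges_append:
  "card (traversed_edges s (h @ g)) \<le> card (traversed_edges s h) + length g"
proof (induction g rule: rev_induct)
  case (snoc e g)
  obtain p q u d where "e = (p, q, u, d)" by (cases e)
  then have "card (traversed_edges s ((h @ g) @ [e])) \<le> Suc (card (traversed_edges s (h @ g)))"
    by (simp only: traversed_edges_snoc) (simp add: card_insert_if)
  then show ?case using snoc by simp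
qed simp

definition retraversals :: "int \<Rightarrow> history \<Rightarrow> int \<Rightarrow> nat" where
  "retraversals s h x = card {i. i < length h \<and> position s (take i h) = x \<and>
     {x, position s (take (Suc i) h)} \<in> traversed_edges s (take i h)}"

lemma retraversals_Nil [simp]: "retraversals s [] x = 0"
  by (simp add: retraversals_def)

lemma retraversals_snoc:
  "retraversals s (h @ [(p, q, u, d)]) x =
     retraversals s h x + of_bool (x = position s h \<and> {x, u} \<in> traversed_edges s h)"
proof -
  let ?R = "\<lambda>h i. position s (take i h) = x \<and>
    {x, position s (take (Suc i) h)} \<in> traversed_edges s (take i h)"
  let ?h = "h @ [(p, q, u, d)]"
  have "{i. i < length ?h \<and> ?R ?h i} =
      {i. i < length h \<and> ?R h i} \<union> {i. i = length h \<and> ?R ?h i}"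
    by (auto simp: less_Suc_eq)
  moreover have "{i. i = length h \<and> ?R ?h i} =
      (if x = position s h \<and> {x, u} \<in> traversed_edges s h then {length h} else {})"
    by auto
  ultimately show ?thesis by (simp add: retraversals_def)
qed

lemma card_traversed_edges_plus_retraversals:
  assumes "finite X" "set (visited_nodes s h) \<subseteq> X"
  shows "card (traversed_edges s h) + (\<Sum>x\<in>X. retraversals s h x) = length h"
  using assms(2)
proof (induction h rule: rev_induct)
  case (snoc e h)
  obtain p q u d where e: "e = (p, q, u, d)" by (cases e)
  have "position s h \<in> X"
    using snoc.prems position_in_visited_nodes[of s h] by (auto simp: e)
  have "(\<Sum>x\<in>X. of_bool (x = position s h \<and> {x, u} \<in> traversed_edges s h)) =
      (\<Sum>x\<in>X. if x = position s h then of_bool ({x, u} \<in> traversed_edges s h) else 0 :: nat)"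
    by (rule sum.cong) auto
  also have "\<dots> = of_bool ({position s h, u} \<in> traversed_edges s h)"
    using assms(1) \<open>position s h \<in> X\<close> by simp
  finally show ?case
    using snoc by (simp add: e retraversals_snoc sum.distrib card_insert_if)
qed simp

lemma execution_appendD:
  "execution A G s (h @ g) v \<Longrightarrow> \<exists>w. execution A G s h w"
  using execution_prefix[of A G s "h @ g" v "length h"] by (cases "g = []") auto

lemma execution_take_eq:
  assumes G: "valid_graph G" "s \<in> verts G"
    and h: "execution A G s h v" and h': "execution A G s h' v'" and le: "length h \<le> length h'"
  shows "take (length h) h' = h"
proof -
  obtain w where "execution A G s (take (length h) h') w"
    using execution_appendD[of A G s "take (length h) h'" "drop (length h) h'"] h' by auto
  from execution_deterministic[OF G h this] le show ?thesis by simp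
qed

lemma execution_extends_to_terminating:
  assumes G: "valid_graph G" "s \<in> verts G"
    and h: "execution A G s h v" and h': "terminates_with A G s h'"
  shows "\<exists>g. h' = h @ g"
proof -
  obtain v' where v': "execution A G s h' v'" using h' by (auto simp: terminates_with_def)
  have "length h \<le> length h'"
  proof (rule ccontr)
    assume "\<not> ?thesis"
    then have less: "length h' < length h" by simp
    then have "A (s, deg G s) (take (length h') h) \<noteq> None"
      using execution_prefix[OF h] by blast
    then show False
      using execution_take_eq[OF G v' h] less h' by (simp add: terminates_with_def)
  qed
  then have "h' = h @ drop (length h) h'"
    using execution_take_eq[OF G h v'] append_take_drop_id[of "length h" h'] by simp
  then show ?thesis ..
qed

lemma explores_continues:
  assumes "valid_graph G" "s \<in> verts G" "explores A G s" "execution A G s h v"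
    and unexplored: "\<not> edges G \<subseteq> traversed_edges s h"
  obtains e g where "terminates_with A G s (h @ e # g)"
    "edges G \<subseteq> traversed_edges s (h @ e # g)"
proof -
  obtain h' where h': "terminates_with A G s h'" "edges G \<subseteq> traversed_edges s h'"
    using assms(3) by (auto simp: explores_def)
  obtain g where "h' = h @ g"
    using execution_extends_to_terminating[OF assms(1,2,4) h'(1)] by blast
  with h' unexplored show thesis by (cases g) (auto intro: that)
qed

lemma explores_next_port:
  assumes G: "valid_graph G" "s \<in> verts G"
    and "explores A G s" and h: "execution A G s h v"
    and "\<not> edges G \<subseteq> traversed_edges s h"
  obtains u where "u \<in> neighbours G v" "A (s, deg G s) h = Some (port G v u)"
proof -
  obtain e g where "terminates_with A G s (h @ e # g)"
    using explores_continues[OF assms] .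
  then obtain w where "execution A G s (h @ [e]) w"
    using execution_appendD[of A G s "h @ [e]" g] by (auto simp: terminates_with_def)
  then show ?thesis
  proof (cases rule: execution.cases)
    case (move h' v' p)
    then have "v' = v" using execution_deterministic[OF G h] by auto
    then show ?thesis using that move by auto
  qed auto
qed

lemma retraversals_le_penalty:
  assumes G: "valid_graph G" "s \<in> verts G"
    and "explores A G s" and "execution A G s h v"
    and "\<not> edges G \<subseteq> traversed_edges s h"
    and X: "finite X" "set (visited_nodes s h) \<subseteq> X"
  shows "int (\<Sum>x\<in>X. retraversals s h x) \<le> penalty A G s"
proof -
  obtain e g where final: "terminates_with A G s (h @ e # g)"
    "edges G \<subseteq> traversed_edges s (h @ e # g)"
    using explores_continues[OF assms(1-5)] .
  have "(THE h. terminates_with A G s h) = h @ e # g"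
    using final(1) terminates_with_unique[OF G] by blast
  then have "traversals A G s = length h + length (e # g)"
    by (simp add: traversals_def)
  moreover have "card (edges G) \<le> card (traversed_edges s h) + length (e # g)"
    using card_traversed_edges_append[of s h "e # g"] card_mono[OF _ final(2)] by simp
  ultimately show ?thesis
    using card_traversed_edges_plus_retraversals[OF X] unfolding penalty_def by linarith
qed

section \<open>The layered chain\<close>

locale layering =
  fixes V :: "int set" and lay :: "int \<Rightarrow> nat"
begin

definition layer :: "nat \<Rightarrow> int set" where
  "layer j = {x \<in> V. lay x = j}"

definition band :: "nat \<Rightarrow> int set set" where
  "band j = edges_between (layer j) (layer (Suc j))"

end

locale layered_chain = layering V lay for V lay +
  fixes s :: int and m N :: nat
  assumes finite_V: "finite V"
    and V_nonneg: "x \<in> V \<Longrightarrow> 0 \<le> x"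
    and lay_le: "x \<in> V \<Longrightarrow> lay x \<le> N"
    and layer_0: "layer 0 = {s}"
    and card_layer: "\<lbrakk>1 \<le> j; j \<le> N\<rbrakk> \<Longrightarrow> card (layer j) = m"
    and N_ge: "2 \<le> N"
    and m_pos: "0 < m"
begin

definition chain_edges :: "int set set" where
  "chain_edges = (\<Union>j<N. band j)"

definition chain_degree :: "int \<Rightarrow> nat" where
  "chain_degree x = card (adj chain_edges x)"

definition up_degree :: "int set set \<Rightarrow> int \<Rightarrow> nat" where
  "up_degree F x = card (adj F x \<inter> layer (Suc (lay x)))"

text \<open>Truncated subtraction is harmless here: if \<open>lay x = 0\<close>, no chain edge joins \<open>x\<close> to layer \<open>0\<close>.\<close>

definition down_degree :: "int set set \<Rightarrow> int \<Rightarrow> nat" where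
  "down_degree F x = card (adj F x \<inter> layer (lay x - 1))"

definition realizes :: "port_graph \<Rightarrow> int set set \<Rightarrow> (int \<Rightarrow> int \<Rightarrow> nat) \<Rightarrow> bool" where
  "realizes G F P \<longleftrightarrow> F \<subseteq> edges G \<and> (\<forall>x\<in>V. deg G x = chain_degree x) \<and>
     (\<forall>x u. {x, u} \<in> F \<longrightarrow> port G x u = P x u)"

definition no_full_band :: "int set set \<Rightarrow> bool" where
  "no_full_band F \<longleftrightarrow> (\<forall>j. 1 \<le> j \<longrightarrow> j < N \<longrightarrow> \<not> band j \<subseteq> F)"

lemma s_in_V: "s \<in> V" and lay_s: "lay s = 0"
  using layer_0 by (auto simp: layer_def)

lemma finite_layer [simp]: "finite (layer j)"
  using finite_V by (simp add: layer_def)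

lemma card_layer_le: "j \<le> N \<Longrightarrow> card (layer j) \<le> m"
  using card_layer[of j] layer_0 m_pos by (cases "j = 0") auto

lemma card_V: "card V = Suc (m * N)"
proof -
  have "card V = card (\<Union>j\<le>N. layer j)"
    using lay_le by (intro arg_cong[of _ _ card]) (auto simp: layer_def)
  also have "\<dots> = (\<Sum>j\<le>N. card (layer j))"
    by (rule card_UN_disjoint) (auto simp: layer_def finite_V)
  also have "\<dots> = card (layer 0) + (\<Sum>j=1..N. card (layer j))"
    by (simp add: atMost_atLeast0 sum.atLeast_Suc_atMost)
  also have "\<dots> = Suc (m * N)"
    by (simp add: layer_0 card_layer)
  finally show ?thesis .
qed

lemma mem_band_iff:
  "{x, y} \<in> band j \<longleftrightarrow> x \<in> V \<and> y \<in> V \<and>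
     (lay x = j \<and> lay y = Suc j \<or> lay y = j \<and> lay x = Suc j)"
  by (auto simp: band_def edges_between_def layer_def doubleton_eq_iff)

lemma bandE:
  assumes "f \<in> band j"
  obtains a b where "f = {a, b}" "a \<in> layer j" "b \<in> layer (Suc j)"
  using assms by (auto simp: band_def edges_between_def)

lemma band_index_unique:
  assumes "f \<in> band i" "f \<in> band j"
  shows "i = j"
proof -
  obtain a b where "f = {a, b}" using assms(1) by (elim bandE)
  then show ?thesis using assms by (auto simp: mem_band_iff)
qed

lemma finite_band: "finite (band j)"
  by (simp add: band_def finite_edges_between)

lemma card_band: "\<lbrakk>1 \<le> j; j < N\<rbrakk> \<Longrightarrow> card (band j) = m * m"
  unfolding band_def by (subst card_edges_between) (auto simp: card_layer, auto simp: layer_def)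

lemma chain_edge_iff:
  "{x, y} \<in> chain_edges \<longleftrightarrow> x \<in> V \<and> y \<in> V \<and> (lay y = Suc (lay x) \<or> lay x = Suc (lay y))"
  using lay_le[of x] lay_le[of y] by (auto simp: chain_edges_def mem_band_iff Suc_le_eq)

lemma chain_edge_neq: "{x, y} \<in> chain_edges \<Longrightarrow> x \<noteq> y"
  by (auto simp: chain_edge_iff)

lemma band_subset_chain_edges: "j < N \<Longrightarrow> band j \<subseteq> chain_edges"
  by (auto simp: chain_edges_def)

lemma finite_chain_edges: "finite chain_edges"
  by (simp add: chain_edges_def finite_band)

lemma finite_adj_chain: "F \<subseteq> chain_edges \<Longrightarrow> finite (adj F x)"
  by (rule finite_subset[OF _ finite_V]) (auto simp: chain_edge_iff)

lemma adj_eq_empty: "\<lbrakk>F \<subseteq> chain_edges; x \<notin> V\<rbrakk> \<Longrightarrow> adj F x = {}"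
  by (auto simp: chain_edge_iff)

lemma sum_up_degree: "(\<Sum>x\<in>layer j. up_degree F x) = card (F \<inter> band j)"
proof -
  have "(\<Sum>x\<in>layer j. up_degree F x) = (\<Sum>x\<in>layer j. card (adj F x \<inter> layer (Suc j)))"
    by (rule sum.cong) (auto simp: up_degree_def layer_def)
  also have "\<dots> = card (F \<inter> band j)"
    unfolding band_def by (rule sum_card_adj_between) (auto simp: layer_def finite_V)
  finally show ?thesis .
qed

lemma sum_down_degree: "(\<Sum>x\<in>layer (Suc j). down_degree F x) = card (F \<inter> band j)"
proof -
  have "(\<Sum>x\<in>layer (Suc j). down_degree F x) = (\<Sum>x\<in>layer (Suc j). card (adj F x \<inter> layer j))"
    by (rule sum.cong) (auto simp: down_degree_def layer_def)
  also have "\<dots> = card (F \<inter> edges_between (layer (Suc j)) (layer j))"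
    by (rule sum_card_adj_between) (auto simp: layer_def finite_V)
  finally show ?thesis by (simp add: band_def edges_between_commute)
qed

end

section \<open>Completions of the chain\<close>

text \<open>Subdividing the edges \<open>cut j\<close> preserves the degrees of the chain nodes, so an agent that has
  traversed none of these edges cannot tell the completion from the chain.\<close>

locale completed_chain = layered_chain +
  fixes r :: nat and cut :: "nat \<Rightarrow> int set"
  assumes r_ge: "6 \<le> r"
    and cut_in_band: "\<lbrakk>1 \<le> j; j < N\<rbrakk> \<Longrightarrow> cut j \<in> band j"
begin

definition mid :: "nat \<Rightarrow> int" where
  "mid j = - int j"

definition tail :: "nat \<Rightarrow> int" where
  "tail i = - int (N + i)"

definition completion_edges :: "int set set" where
  "completion_edges = subdivision chain_edges cut mid {1..<N}
     \<union> {{mid j, tail 0} | j. 1 \<le> j \<and> j < N}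
     \<union> {{tail i, tail (Suc i)} | i. i < r - 3}"

definition completion_verts :: "int set" where
  "completion_verts = V \<union> mid ` {1..<N} \<union> tail ` {..r - 3}"

lemma mid_eq_iff [simp]: "mid i = mid j \<longleftrightarrow> i = j" and tail_eq_iff [simp]: "tail i = tail j \<longleftrightarrow> i = j"
  by (simp_all add: mid_def tail_def)

lemma mid_neq_tail [simp]: "j < N \<Longrightarrow> mid j \<noteq> tail i" "j < N \<Longrightarrow> tail i \<noteq> mid j"
  by (simp_all add: mid_def tail_def)

lemma mid_notin_V [simp]: "1 \<le> j \<Longrightarrow> mid j \<notin> V" and tail_notin_V [simp]: "tail i \<notin> V"
  using V_nonneg[of "mid j"] V_nonneg[of "tail i"] N_ge by (auto simp: mid_def tail_def)

lemma mem_cut: "\<lbrakk>1 \<le> j; j < N; x \<in> cut j\<rbrakk> \<Longrightarrow> x \<in> V \<and> (lay x = j \<or> lay x = Suc j)"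
  using cut_in_band[of j] by (auto elim!: bandE simp: layer_def)

lemma inj_on_cut: "inj_on cut {1..<N}"
proof (rule inj_onI)
  fix i j assume "i \<in> {1..<N}" "j \<in> {1..<N}" "cut i = cut j"
  then show "i = j"
    using cut_in_band[of i] cut_in_band[of j] band_index_unique[of "cut i" i j] by simp
qed

lemma card_cut: "\<lbrakk>1 \<le> j; j < N\<rbrakk> \<Longrightarrow> card (cut j) = 2"
  using cut_in_band[of j] by (auto elim!: bandE simp: layer_def card_insert_if)

lemma chain_edge_in_completion:
  "\<lbrakk>f \<in> chain_edges; f \<notin> cut ` {1..<N}\<rbrakk> \<Longrightarrow> f \<in> completion_edges"
  by (simp add: completion_edges_def subdivision_def)

lemma mid_edge_in_completion: "\<lbrakk>1 \<le> j; j < N; x \<in> cut j\<rbrakk> \<Longrightarrow> {x, mid j} \<in> completion_edges"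
  unfolding completion_edges_def subdivision_def by auto

lemma hub_edge_in_completion: "\<lbrakk>1 \<le> j; j < N\<rbrakk> \<Longrightarrow> {mid j, tail 0} \<in> completion_edges"
  unfolding completion_edges_def by auto

lemma tail_edge_in_completion: "i < r - 3 \<Longrightarrow> {tail i, tail (Suc i)} \<in> completion_edges"
  unfolding completion_edges_def by auto

lemma completion_edgeE:
  assumes "f \<in> completion_edges"
  obtains (chain) a b where "f = {a, b}" "{a, b} \<in> chain_edges"
  | (mid) j x where "1 \<le> j" "j < N" "x \<in> cut j" "f = {x, mid j}"
  | (hub) j where "1 \<le> j" "j < N" "f = {mid j, tail 0}"
  | (tail) i where "i < r - 3" "f = {tail i, tail (Suc i)}"
proof -
  consider "f \<in> chain_edges" | j x where "1 \<le> j" "j < N" "x \<in> cut j" "f = {x, mid j}"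
    | j where "1 \<le> j" "j < N" "f = {mid j, tail 0}"
    | i where "i < r - 3" "f = {tail i, tail (Suc i)}"
    using assms unfolding completion_edges_def subdivision_def by auto
  then show thesis
  proof cases
    case 1
    moreover from this obtain a b where "f = {a, b}" by (auto simp: chain_edges_def elim: bandE)
    ultimately show ?thesis using chain by simp
  qed (use mid hub tail in blast)+
qed

lemma completion_edges_simple:
  "completion_edges \<subseteq> {{a, b} | a b. a \<in> completion_verts \<and> b \<in> completion_verts \<and> a \<noteq> b}"
proof
  fix f assume "f \<in> completion_edges"
  then have "\<exists>a b. f = {a, b} \<and> a \<in> completion_verts \<and> b \<in> completion_verts \<and> a \<noteq> b"
  proof (cases rule: completion_edgeE)
    case (chain a b)
    then show ?thesis
      by (intro exI[of _ a] exI[of _ b]) (auto simp: chain_edge_iff completion_verts_def)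
  next
    case (mid j x)
    then show ?thesis using mem_cut[of j x] mid_notin_V[of j]
      by (intro exI[of _ x] exI[of _ "mid j"]) (auto simp: completion_verts_def)
  next
    case (hub j)
    then show ?thesis
      by (intro exI[of _ "mid j"] exI[of _ "tail 0"]) (auto simp: completion_verts_def)
  next
    case (tail i)
    then show ?thesis
      by (intro exI[of _ "tail i"] exI[of _ "tail (Suc i)"]) (auto simp: completion_verts_def)
  qed
  then show "f \<in> {{a, b} | a b. a \<in> completion_verts \<and> b \<in> completion_verts \<and> a \<noteq> b}"
    by blast
qed

lemma finite_completion_verts: "finite completion_verts"
  by (simp add: completion_verts_def finite_V)

lemma finite_adj_completion: "finite (adj completion_edges x)"
  by (rule finite_subset[OF _ finite_completion_verts])
    (use completion_edges_simple in \<open>fastforce simp: doubleton_eq_iff\<close>)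

lemma card_adj_completion:
  assumes "x \<in> V"
  shows "card (adj completion_edges x) = chain_degree x"
proof -
  have notin: "x \<notin> mid ` {1..<N}" "x \<notin> range tail" using assms by auto
  then have "adj completion_edges x = adj (subdivision chain_edges cut mid {1..<N}) x"
    by (auto simp: completion_edges_def doubleton_eq_iff)
  also have "card \<dots> = card (adj chain_edges x)"
  proof (rule card_adj_subdivision)
    show "cut ` {1..<N} \<subseteq> chain_edges"
      using cut_in_band band_subset_chain_edges by fastforce
    have "\<Union>chain_edges \<subseteq> V"
      by (auto simp: chain_edges_def layer_def elim!: bandE)
    then show "mid ` {1..<N} \<inter> \<Union>chain_edges = {}"
      using mid_notin_V by fastforce
    show "inj_on mid {1..<N}" by (simp add: inj_on_def)
  qed (use notin card_cut inj_on_cut finite_adj_chain in auto)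
  finally show ?thesis by (simp add: chain_degree_def)
qed

lemma card_completion_verts: "card completion_verts = card V + (N + r - 3)"
proof -
  have "card completion_verts = card V + card (mid ` {1..<N}) + card (tail ` {..r - 3})"
    unfolding completion_verts_def
    by (subst card_Un_disjoint; (subst card_Un_disjoint)?) (auto simp: finite_V)
  also have "card (mid ` {1..<N}) = N - 1" by (simp add: card_image inj_on_def)
  also have "card (tail ` {..r - 3}) = Suc (r - 3)" by (simp add: card_image inj_on_def)
  finally show ?thesis using N_ge r_ge by simp
qed

lemma completion_unexplored:
  assumes "F \<subseteq> chain_edges"
  shows "\<not> completion_edges \<subseteq> F"
proof
  assume "completion_edges \<subseteq> F"
  then have "{mid 1, tail 0} \<in> chain_edges"
    using hub_edge_in_completion[of 1] N_ge assms by auto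
  then show False by (simp add: chain_edge_iff)
qed

abbreviation reach :: "nat \<Rightarrow> int \<Rightarrow> bool" where
  "reach n v \<equiv> walk_within completion_edges n s v"

lemma reach_layer_1:
  assumes "x \<in> layer 1"
  shows "reach 1 x"
proof (intro walk_within_edge chain_edge_in_completion)
  have x: "{s, x} \<in> band 0"
    using assms s_in_V lay_s by (simp add: mem_band_iff layer_def)
  then show "{s, x} \<in> chain_edges"
    using band_subset_chain_edges[of 0] N_ge by auto
  show "{s, x} \<notin> cut ` {1..<N}"
    using x cut_in_band band_index_unique by fastforce
qed

lemma reach_tail: "i \<le> r - 3 \<Longrightarrow> reach (3 + i) (tail i)"
proof (induction i)
  case 0
  obtain x where x: "x \<in> layer 1" "x \<in> cut 1"
    using cut_in_band[of 1] N_ge by (auto elim: bandE)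
  then have "reach 2 (mid 1)"
    using walk_within_step[OF reach_layer_1 mid_edge_in_completion[of 1]] N_ge
    by (simp add: numeral_2_eq_2)
  then show ?case
    using walk_within_step[OF _ hub_edge_in_completion[of 1]] N_ge by fastforce
next
  case (Suc i)
  then show ?case using walk_within_step[OF _ tail_edge_in_completion[of i], of "3 + i"] by simp
qed

lemma reach_mid:
  assumes "1 \<le> j" "j < N"
  shows "reach 4 (mid j)"
proof -
  have "{tail 0, mid j} \<in> completion_edges"
    using hub_edge_in_completion[OF assms] by (simp add: insert_commute)
  then show ?thesis using walk_within_step[of _ 3 s "tail 0"] reach_tail[of 0] by simp
qed

lemma reach_cut:
  assumes "1 \<le> j" "j < N" "x \<in> cut j"
  shows "reach 5 x"
proof -
  have "{mid j, x} \<in> completion_edges"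
    using mid_edge_in_completion[OF assms] by (simp add: insert_commute)
  then show ?thesis using walk_within_step[OF reach_mid[OF assms(1,2)]] by simp
qed

lemma reach_layer_Suc:
  assumes j: "1 \<le> j" "j < N" and x: "x \<in> layer (Suc j)"
  shows "reach 6 x"
proof -
  obtain a b where ab: "cut j = {a, b}" "a \<in> layer j" "b \<in> layer (Suc j)"
    using cut_in_band[OF j] by (elim bandE)
  show ?thesis
  proof (cases "x = b")
    case True
    then show ?thesis using walk_within_mono[OF reach_cut[OF j]] ab by simp
  next
    case False
    have ax: "{a, x} \<in> band j" using ab(2) x by (simp add: mem_band_iff layer_def)
    have "{a, x} \<noteq> cut j" using False ab x by (auto simp: doubleton_eq_iff layer_def)
    then have "{a, x} \<notin> cut ` {1..<N}"
      using ax cut_in_band band_index_unique by fastforce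
    then have "{a, x} \<in> completion_edges"
      using ax band_subset_chain_edges[OF j(2)] by (intro chain_edge_in_completion) auto
    then show ?thesis using walk_within_step[OF reach_cut[OF j]] ab(1) by fastforce
  qed
qed

lemma reach_V:
  assumes x: "x \<in> V"
  shows "reach 6 x"
proof -
  consider "lay x = 0" | "lay x = 1" | "2 \<le> lay x" by linarith
  then show ?thesis
  proof cases
    case 1
    then have "x = s" using x layer_0 by (auto simp: layer_def)
    then show ?thesis using walk_within_mono[OF walk_within_refl] by simp
  next
    case 2
    then show ?thesis using walk_within_mono[OF reach_layer_1] x by (simp add: layer_def)
  next
    case 3
    then show ?thesis using reach_layer_Suc[of "lay x - 1" x] x lay_le[OF x]
      by (simp add: layer_def)
  qed
qed

lemma reach_completion_verts:
  assumes "v \<in> completion_verts"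
  shows "reach r v"
proof -
  consider "v \<in> V" | j where "1 \<le> j" "j < N" "v = mid j" | i where "i \<le> r - 3" "v = tail i"
    using assms by (auto simp: completion_verts_def)
  then show ?thesis
  proof cases
    case 1
    show ?thesis using walk_within_mono[OF reach_V[OF 1] r_ge] .
  next
    case (2 j)
    then show ?thesis using walk_within_mono[OF reach_mid] r_ge by simp
  next
    case (3 i)
    then show ?thesis using walk_within_mono[OF reach_tail] r_ge by simp
  qed
qed

definition level :: "int \<Rightarrow> nat" where
  "level v = (if 0 \<le> v then min 2 (lay v) else max 2 (3 + nat (- v) - N))"

lemma level_V: "x \<in> V \<Longrightarrow> level x = min 2 (lay x)"
  and level_mid: "\<lbrakk>1 \<le> j; j < N\<rbrakk> \<Longrightarrow> level (mid j) = 2"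
  and level_tail: "level (tail i) = 3 + i"
  using V_nonneg N_ge by (auto simp: level_def mid_def tail_def nat_add_distrib)

lemma level_step:
  assumes "{a, b} \<in> completion_edges"
  shows "level b \<le> Suc (level a)"
  using assms
proof (cases rule: completion_edgeE)
  case (chain a' b')
  then show ?thesis by (auto simp: chain_edge_iff level_V doubleton_eq_iff)
next
  case (mid j x)
  then show ?thesis using mem_cut[of j x] by (auto simp: doubleton_eq_iff level_V level_mid)
qed (auto simp: doubleton_eq_iff level_mid level_tail)

lemma
  assumes G: "edges G = completion_edges" "verts G = completion_verts"
    and ports: "\<And>v. bij_betw (port G v) (adj (edges G) v) {..<card (adj (edges G) v)}"
  shows valid_graph_completion: "valid_graph G"
    and eccentricity_completion: "eccentricity G s = r"
proof -
  show "valid_graph G"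
    using completion_edges_simple finite_completion_verts reach_completion_verts ports
    by (intro valid_graphI) (auto simp: G)
  show "eccentricity G s = r"
  proof (rule eccentricity_eqI)
    show "tail (r - 3) \<in> verts G" by (simp add: G completion_verts_def)
    show "level s + r \<le> level (tail (r - 3))"
      using s_in_V lay_s r_ge by (simp add: level_V level_tail)
  qed (use finite_completion_verts reach_completion_verts level_step in \<open>auto simp: G\<close>)
qed

lemma completion_realizes:
  assumes F: "F \<subseteq> chain_edges" "F \<inter> cut ` {1..<N} = {}" and P: "partial_ports chain_degree F P"
  obtains G where "edges G = completion_edges" "verts G = completion_verts"
    "\<And>v. bij_betw (port G v) (adj (edges G) v) {..<card (adj (edges G) v)}" "realizes G F P"
proof -
  have sub: "F \<subseteq> completion_edges"
    using F by (intro subsetI chain_edge_in_completion) auto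
  have "partial_ports (\<lambda>x. card (adj completion_edges x)) F P"
    unfolding partial_ports_def
  proof
    fix x
    show "inj_on (P x) (adj F x) \<and> P x ` adj F x \<subseteq> {..<card (adj completion_edges x)}"
      using P adj_eq_empty[OF F(1), of x] card_adj_completion[of x]
      by (cases "x \<in> V") (auto simp: partial_ports_def)
  qed
  then obtain Q where Q:
    "\<And>x. bij_betw (Q x) (adj completion_edges x) {..<card (adj completion_edges x)}"
    "\<And>x y. {x, y} \<in> F \<Longrightarrow> Q x y = P x y"
    using partial_ports_extend[OF _ sub finite_adj_completion] by blast
  show thesis
    by (rule that[of "\<lparr>verts = completion_verts, edges = completion_edges, port = Q\<rparr>"])
      (use Q sub in \<open>auto simp: realizes_def deg_def neighbours_eq_adj card_adj_completion\<close>)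
qed

end

lemma (in layered_chain) completion_exists:
  assumes r: "6 \<le> r" and F: "F \<subseteq> chain_edges" "no_full_band F"
    and P: "partial_ports chain_degree F P"
  obtains G where "valid_graph G" "s \<in> verts G" "eccentricity G s = r" "realizes G F P"
    "\<not> edges G \<subseteq> F" "card (verts G) = card V + (N + r - 3)"
proof -
  have "\<forall>j. \<exists>f. 1 \<le> j \<longrightarrow> j < N \<longrightarrow> f \<in> band j \<and> f \<notin> F"
    using F(2) by (auto simp: no_full_band_def)
  then obtain cut where cut: "\<And>j. \<lbrakk>1 \<le> j; j < N\<rbrakk> \<Longrightarrow> cut j \<in> band j \<and> cut j \<notin> F"
    by metis
  interpret completed_chain V lay s m N r cut
    by unfold_locales (use r cut in auto)
  have "F \<inter> cut ` {1..<N} = {}" using cut by auto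
  then obtain G where G: "edges G = completion_edges" "verts G = completion_verts"
    "\<And>v. bij_betw (port G v) (adj (edges G) v) {..<card (adj (edges G) v)}" "realizes G F P"
    using completion_realizes[OF F(1) _ P] by blast
  have "s \<in> verts G" using s_in_V by (simp add: G completion_verts_def)
  then show thesis
    using that[OF valid_graph_completion[OF G(1-3)] _ eccentricity_completion[OF G(1-3)] G(4)]
      completion_unexplored[OF F(1)] card_completion_verts G by simp
qed

section \<open>Forward-first walks\<close>

context layered_chain
begin

lemma up_degree_le_insert: "up_degree F x \<le> up_degree (insert f F) x"
  unfolding up_degree_def by (intro card_mono) auto

lemma up_degree_insert:
  assumes "u \<in> V" "lay u = Suc (lay v)" "{v, u} \<notin> F"
  shows "up_degree (insert {v, u} F) v = Suc (up_degree F v)"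
proof -
  have "adj (insert {v, u} F) v \<inter> layer (Suc (lay v)) =
      insert u (adj F v \<inter> layer (Suc (lay v)))"
    using assms by (auto simp: doubleton_eq_iff layer_def)
  then show ?thesis using assms(3) by (simp add: up_degree_def)
qed

lemma up_degree_eq_m:
  assumes "lay x < N" "layer (Suc (lay x)) \<subseteq> adj F x"
  shows "up_degree F x = m"
proof -
  have "adj F x \<inter> layer (Suc (lay x)) = layer (Suc (lay x))" using assms(2) by blast
  then show ?thesis using assms(1) by (simp add: up_degree_def card_layer)
qed

lemma down_degree_le_m: "lay x \<le> N \<Longrightarrow> down_degree F x \<le> m"
  unfolding down_degree_def
  by (rule order_trans[OF card_mono card_layer_le[of "lay x - 1"]]) auto

lemma down_degree_insert_le:
  assumes "v \<noteq> u"
  shows "down_degree (insert {v, u} F) u \<le> Suc (down_degree F u)"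
proof -
  have "down_degree (insert {v, u} F) u \<le> card (insert v (adj F u \<inter> layer (lay u - 1)))"
    unfolding down_degree_def using assms by (intro card_mono) (auto simp: adj_insert)
  then show ?thesis by (simp add: down_degree_def card_insert_if split: if_splits)
qed

lemma down_degree_insert_eq:
  assumes "v \<noteq> u" "x \<noteq> u" "x = v \<Longrightarrow> lay u = Suc (lay v)"
  shows "down_degree (insert {v, u} F) x = down_degree F x"
  unfolding down_degree_def using assms
  by (intro arg_cong[of _ _ card]) (auto simp: adj_insert layer_def)

definition forward_first :: "int set set \<Rightarrow> int \<Rightarrow> int \<Rightarrow> bool" where
  "forward_first F v u \<longleftrightarrow>
     {v, u} \<in> F \<or> lay u = Suc (lay v) \<or> layer (Suc (lay v)) \<subseteq> adj F v"

lemma ex_forward_first_edge: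
  assumes "F \<subseteq> chain_edges" "card (adj F v) < chain_degree v"
  obtains u where "{v, u} \<in> chain_edges" "{v, u} \<notin> F" "forward_first F v u"
proof -
  have "\<not> adj chain_edges v \<subseteq> adj F v"
    using assms(2) card_mono[OF finite_adj_chain[OF assms(1)], of "adj chain_edges v" v]
    by (auto simp: chain_degree_def)
  then obtain z where "z \<in> adj chain_edges v" "z \<notin> adj F v" by blast
  then have z: "{v, z} \<in> chain_edges" "{v, z} \<notin> F" by simp_all
  show thesis
  proof (cases "layer (Suc (lay v)) \<subseteq> adj F v")
    case True
    then show ?thesis using that z by (simp add: forward_first_def)
  next
    case False
    then obtain u where "u \<in> layer (Suc (lay v))" "u \<notin> adj F v" by blast
    then have u: "u \<in> V" "lay u = Suc (lay v)" "{v, u} \<notin> F" by (simp_all add: layer_def)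
    moreover have "{v, u} \<in> chain_edges" using u z(1) by (simp add: chain_edge_iff)
    ultimately show ?thesis using that by (simp add: forward_first_def)
  qed
qed

lemma down_degree_le_after_departure:
  assumes v: "lay v < N" and edge: "{v, u} \<in> chain_edges" and ff: "forward_first F v u"
    and before: "down_degree F v \<le> up_degree F v + n + 1"
  shows "down_degree (insert {v, u} F) v \<le>
    up_degree (insert {v, u} F) v + n + of_bool ({v, u} \<in> F)"
proof -
  consider (old) "{v, u} \<in> F" | (up) "{v, u} \<notin> F" "lay u = Suc (lay v)"
    | (saturated) "layer (Suc (lay v)) \<subseteq> adj F v"
    using ff by (auto simp: forward_first_def)
  then show ?thesis
  proof cases
    case old
    then show ?thesis using before by (simp add: insert_absorb)
  next
    case up
    have "v \<noteq> u" using edge by (rule chain_edge_neq)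
    then have "down_degree (insert {v, u} F) v = down_degree F v"
      using up(2) by (intro down_degree_insert_eq) simp_all
    moreover have "up_degree (insert {v, u} F) v = Suc (up_degree F v)"
      using edge up by (intro up_degree_insert) (auto simp: chain_edge_iff)
    ultimately show ?thesis using before by simp
  next
    case saturated
    then have "up_degree (insert {v, u} F) v = m" using v by (intro up_degree_eq_m) auto
    then show ?thesis using down_degree_le_m[of v "insert {v, u} F"] v by simp
  qed
qed

definition balanced :: "history \<Rightarrow> bool" where
  "balanced h \<longleftrightarrow> (\<forall>x\<in>V. 1 \<le> lay x \<longrightarrow> lay x < N \<longrightarrow>
     down_degree (traversed_edges s h) x \<le>
       up_degree (traversed_edges s h) x + retraversals s h x + of_bool (x = position s h))"

lemma balanced_Nil: "balanced []"
  by (simp add: balanced_def down_degree_def)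

lemma balanced_snoc:
  assumes bal: "balanced h" and v: "v = position s h" "lay v < N"
    and edge: "{v, u} \<in> chain_edges" and ff: "forward_first (traversed_edges s h) v u"
  shows "balanced (h @ [(p, q, u, d)])"
  unfolding balanced_def traversed_edges_snoc position_snoc retraversals_snoc v(1)[symmetric]
proof (intro ballI impI)
  let ?F = "traversed_edges s h"
  let ?F' = "insert {v, u} ?F"
  fix x assume x: "x \<in> V" "1 \<le> lay x" "lay x < N"
  have vu: "v \<noteq> u" using edge by (rule chain_edge_neq)
  have before: "down_degree ?F x \<le> up_degree ?F x + retraversals s h x + of_bool (x = v)"
    using bal x v(1) by (simp add: balanced_def)
  consider (arrival) "x = u" | (departure) "x = v" | (other) "x \<noteq> u" "x \<noteq> v" by blast
  then show "down_degree ?F' x \<le> up_degree ?F' x +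
      (retraversals s h x + of_bool (x = v \<and> {x, u} \<in> ?F)) + of_bool (x = u)"
  proof cases
    case arrival
    then show ?thesis
      using before vu down_degree_insert_le[OF vu, of ?F] up_degree_le_insert[of ?F u "{v, u}"]
      by simp
  next
    case departure
    then show ?thesis
      using before vu down_degree_le_after_departure[OF v(2) edge ff, of "retraversals s h v"]
      by simp
  next
    case other
    then show ?thesis
      using before down_degree_insert_eq[OF vu, of x] up_degree_le_insert[of ?F x "{v, u}"]
      by simp
  qed
qed

lemma card_traversed_band_le:
  assumes bal: "balanced h" and pos: "position s h \<in> V"
    and top: "traversed_edges s h \<inter> band (N - 1) = {}" and j: "j \<le> N - 1"
  shows "card (traversed_edges s h \<inter> band j) \<le>
    (\<Sum>x | x \<in> V \<and> j < lay x. retraversals s h x) + of_bool (j < lay (position s h))"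
  using j
proof (induction j rule: inc_induct)
  case base
  show ?case by (simp only: top card.empty zero_le)
next
  case (step j)
  let ?F = "traversed_edges s h" and ?R = "retraversals s h" and ?v = "position s h"
  have "card (?F \<inter> band j) = (\<Sum>x\<in>layer (Suc j). down_degree ?F x)"
    by (simp add: sum_down_degree)
  also have "\<dots> \<le> (\<Sum>x\<in>layer (Suc j). up_degree ?F x + ?R x + of_bool (x = ?v))"
    using bal step by (intro sum_mono) (auto simp: balanced_def layer_def)
  also have "\<dots> = card (?F \<inter> band (Suc j)) + sum ?R (layer (Suc j)) +
      (\<Sum>x\<in>layer (Suc j). of_bool (x = ?v))"
    by (simp add: sum.distrib sum_up_degree)
  also have "(\<Sum>x\<in>layer (Suc j). of_bool (x = ?v)) = (of_bool (lay ?v = Suc j) :: nat)"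
    using pos by (auto simp: layer_def of_bool_def finite_V)
  also have "card (?F \<inter> band (Suc j)) + sum ?R (layer (Suc j)) + of_bool (lay ?v = Suc j) \<le>
      (\<Sum>x | x \<in> V \<and> Suc j < lay x. ?R x) + of_bool (Suc j < lay ?v) +
      sum ?R (layer (Suc j)) + of_bool (lay ?v = Suc j)"
    using step.IH by simp
  also have "\<dots> = (\<Sum>x\<in>{x \<in> V. Suc j < lay x} \<union> layer (Suc j). ?R x) + of_bool (j < lay ?v)"
    by (subst sum.union_disjoint) (auto simp: finite_V layer_def)
  also have "{x \<in> V. Suc j < lay x} \<union> layer (Suc j) = {x \<in> V. j < lay x}"
    by (auto simp: layer_def)
  finally show ?case .
qed

lemma no_full_band_insert:
  assumes bal: "balanced h" "position s h \<in> V" "traversed_edges s h \<inter> band (N - 1) = {}"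
    and few: "(\<Sum>x\<in>V. retraversals s h x) + 2 < m * m"
  shows "no_full_band (insert f (traversed_edges s h))"
  unfolding no_full_band_def
proof (intro allI impI notI)
  let ?F = "traversed_edges s h"
  fix j assume j: "1 \<le> j" "j < N" and full: "band j \<subseteq> insert f ?F"
  have "m * m = card (band j)" using card_band[OF j] by simp
  also have "\<dots> \<le> card (insert f (?F \<inter> band j))"
    using full by (intro card_mono) auto
  also have "\<dots> \<le> Suc (card (?F \<inter> band j))"
    by (simp add: card_insert_if)
  also have "card (?F \<inter> band j) \<le>
      (\<Sum>x | x \<in> V \<and> j < lay x. retraversals s h x) + of_bool (j < lay (position s h))"
    using j by (intro card_traversed_band_le[OF bal]) simp
  also have "\<dots> \<le> (\<Sum>x\<in>V. retraversals s h x) + 1"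
    by (intro add_mono sum_mono2) (auto simp: finite_V)
  finally show False using few by simp
qed

lemma no_full_band_empty: "no_full_band {}"
proof -
  have "band j \<noteq> {}" if "1 \<le> j" "j < N" for j
    using card_band[OF that] m_pos by auto
  then show ?thesis by (simp add: no_full_band_def)
qed

end

section \<open>The adversary\<close>

locale adversary = layered_chain +
  fixes A :: algorithm and \<alpha> :: real and r :: nat
  assumes solves: "solves A \<alpha> r"
    and r_ge: "6 \<le> r"
    and N_bound: "\<And>n. real n \<le> (1 + \<alpha>) * real r \<Longrightarrow> n < N"
begin

definition consistent :: "history \<Rightarrow> (int \<Rightarrow> int \<Rightarrow> nat) \<Rightarrow> bool" where
  "consistent h P \<longleftrightarrow>
     (\<forall>G. realizes G (traversed_edges s h) P \<longrightarrow> execution A G s h (position s h))"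

definition viable :: "history \<Rightarrow> (int \<Rightarrow> int \<Rightarrow> nat) \<Rightarrow> bool" where
  "viable h P \<longleftrightarrow> set (visited_nodes s h) \<subseteq> V \<and> traversed_edges s h \<subseteq> chain_edges \<and>
     no_full_band (traversed_edges s h) \<and> partial_ports chain_degree (traversed_edges s h) P \<and>
     consistent h P"

lemma viable_position: "viable h P \<Longrightarrow> position s h \<in> V"
  using position_in_visited_nodes[of s h] by (auto simp: viable_def)

lemma viable_instance_exists:
  assumes "viable h P"
  obtains G where "(G, s, \<alpha>) \<in> instances \<alpha> r" "valid_graph G" "s \<in> verts G"
    "realizes G (traversed_edges s h) P" "\<not> edges G \<subseteq> traversed_edges s h"
    "card (verts G) = card V + (N + r - 3)" "execution A G s h (position s h)"
    "explores A G s" "respects_distance A G s ((1 + \<alpha>) * real r)"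
proof -
  obtain G where G: "valid_graph G" "s \<in> verts G" "eccentricity G s = r"
    "realizes G (traversed_edges s h) P" "\<not> edges G \<subseteq> traversed_edges s h"
    "card (verts G) = card V + (N + r - 3)"
    using completion_exists[OF r_ge] assms unfolding viable_def by metis
  then have "(G, s, \<alpha>) \<in> instances \<alpha> r" by (simp add: instances_def)
  moreover have "execution A G s h (position s h)"
    using G(4) assms by (simp add: viable_def consistent_def)
  ultimately show thesis using that G solves by (simp add: solves_def)
qed

lemma viable_lay_less:
  assumes "viable h P"
  shows "lay (position s h) < N"
proof -
  obtain G where "execution A G s h (position s h)" "respects_distance A G s ((1 + \<alpha>) * real r)"
    using viable_instance_exists[OF assms] .
  then obtain xs where xs: "walk_betw (traversed_edges s h) (position s h) xs s"
    "real (walk_length xs) \<le> (1 + \<alpha>) * real r"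
    by (auto simp: respects_distance_def)
  have "traversed_edges s h \<subseteq> chain_edges" using assms by (simp add: viable_def)
  then have "lay (position s h) \<le> lay s + walk_length (rev xs)"
    by (intro walk_betw_potential_le[OF walk_betw_rev[OF xs(1)]])
      (auto simp: chain_edge_iff dest!: subsetD)
  then show ?thesis using N_bound[OF xs(2)] lay_s by (simp add: walk_length_def)
qed

lemma viable_next_port:
  assumes "viable h P"
  obtains p where "A (s, chain_degree s) h = Some p" "p < chain_degree (position s h)"
proof -
  obtain G where G: "valid_graph G" "s \<in> verts G" "realizes G (traversed_edges s h) P"
    "\<not> edges G \<subseteq> traversed_edges s h" "execution A G s h (position s h)" "explores A G s"
    using viable_instance_exists[OF assms] .
  obtain u where u: "u \<in> neighbours G (position s h)"
    "A (s, deg G s) h = Some (port G (position s h) u)"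
    using explores_next_port[OF G(1,2,6,5,4)] .
  have "port G (position s h) u < deg G (position s h)"
    using G(1) u(1) execution_in_verts[OF G(1,2,5)]
    by (auto simp: valid_graph_def dest: bij_betw_apply)
  then show thesis
    using that u(2) G(3) s_in_V viable_position[OF assms] by (simp add: realizes_def)
qed

lemma consistent_snoc:
  assumes "consistent h P" and v: "v = position s h" and u: "u \<in> V"
    and A: "A (s, chain_degree s) h = Some (P' v u)"
    and P': "\<And>x y. {x, y} \<in> traversed_edges s h \<Longrightarrow> P' x y = P x y"
  shows "consistent (h @ [(P' v u, P' u v, u, chain_degree u)]) P'"
  unfolding consistent_def traversed_edges_snoc position_snoc v[symmetric]
proof (intro allI impI)
  fix G assume G: "realizes G (insert {v, u} (traversed_edges s h)) P'"
  then have "realizes G (traversed_edges s h) P" using P' by (auto simp: realizes_def)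
  then have "execution A G s h v" using assms(1) v by (simp add: consistent_def)
  moreover have "port G v u = P' v u" "port G u v = P' u v" "deg G u = chain_degree u"
    "u \<in> neighbours G v" "deg G s = chain_degree s"
    using G u s_in_V by (auto simp: realizes_def neighbours_eq_adj insert_commute)
  ultimately show "execution A G s (h @ [(P' v u, P' u v, u, chain_degree u)]) u"
    using execution.move[of A G s h v "P' v u" u] A by simp
qed

lemma viable_snoc_traversed:
  assumes h: "viable h P" and v: "v = position s h" and edge: "{v, u} \<in> traversed_edges s h"
    and A: "A (s, chain_degree s) h = Some (P v u)"
  shows "viable (h @ [(P v u, P u v, u, chain_degree u)]) P"
proof -
  have "u \<in> V" using h edge by (auto simp: viable_def chain_edge_iff)
  then have "consistent (h @ [(P v u, P u v, u, chain_degree u)]) P"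
    using h v A by (intro consistent_snoc) (auto simp: viable_def)
  then show ?thesis
    using h edge \<open>u \<in> V\<close> v by (simp add: viable_def insert_absorb)
qed

lemma viable_snoc_new:
  assumes h: "viable h P" and v: "v = position s h"
    and edge: "{v, u} \<in> chain_edges" "{v, u} \<notin> traversed_edges s h"
    and gap: "no_full_band (insert {v, u} (traversed_edges s h))"
    and A: "A (s, chain_degree s) h = Some p"
    and p: "p < chain_degree v" "p \<notin> P v ` adj (traversed_edges s h) v"
  obtains q P' where "viable (h @ [(p, q, u, chain_degree u)]) P'"
proof -
  let ?F = "traversed_edges s h"
  have F: "?F \<subseteq> chain_edges" and ports: "partial_ports chain_degree ?F P"
    using h by (simp_all add: viable_def)
  have "adj ?F u \<subset> adj chain_edges u"
    using F edge by (auto simp: insert_commute)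
  then have "card (adj ?F u) < chain_degree u"
    by (simp add: chain_degree_def psubset_card_mono finite_adj_chain)
  then obtain P' where P': "partial_ports chain_degree (insert {v, u} ?F) P'" "P' v u = p"
    "\<And>x y. {x, y} \<in> ?F \<Longrightarrow> P' x y = P x y"
    using partial_ports_insert[OF ports chain_edge_neq[OF edge(1)] edge(2) p] by blast
  have u: "u \<in> V" using edge by (simp add: chain_edge_iff)
  have "consistent (h @ [(p, P' u v, u, chain_degree u)]) P'"
    using consistent_snoc[OF _ v u, of P P'] h A P' by (simp add: viable_def)
  then have "viable (h @ [(p, P' u v, u, chain_degree u)]) P'"
    using h u v edge gap P'(1) by (simp add: viable_def)
  then show thesis by (rule that)
qed

definition adversary_state :: "history \<Rightarrow> (int \<Rightarrow> int \<Rightarrow> nat) \<Rightarrow> bool" where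
  "adversary_state h P \<longleftrightarrow>
     viable h P \<and> balanced h \<and> traversed_edges s h \<inter> band (N - 1) = {}"

lemma adversary_state_Nil: "adversary_state [] P"
  using s_in_V no_full_band_empty balanced_Nil
  by (auto simp: adversary_state_def viable_def visited_nodes_def partial_ports_def consistent_def
      intro: execution.start)

lemma adversary_state_snoc:
  assumes h: "adversary_state h P" and h': "viable (h @ [(p, q, u, d)]) P'"
    and ff: "forward_first (traversed_edges s h) (position s h) u"
  shows "adversary_state (h @ [(p, q, u, d)]) P'"
proof -
  let ?v = "position s h"
  have lay: "lay ?v < N" "lay u < N"
    using viable_lay_less[OF h'] h viable_lay_less by (auto simp: adversary_state_def)
  have edge: "{?v, u} \<in> chain_edges" using h' by (simp add: viable_def)
  have "{?v, u} \<notin> band (N - 1)" using lay by (auto simp: mem_band_iff)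
  then show ?thesis
    using h h' balanced_snoc[OF _ refl lay(1) edge ff] by (simp add: adversary_state_def)
qed

lemma adversary_state_extends:
  assumes h: "adversary_state h P" and few: "(\<Sum>x\<in>V. retraversals s h x) + 2 < m * m"
  shows "\<exists>e P'. adversary_state (h @ [e]) P'"
proof -
  let ?F = "traversed_edges s h" and ?v = "position s h"
  have viable: "viable h P" using h by (simp add: adversary_state_def)
  obtain p where p: "A (s, chain_degree s) h = Some p" "p < chain_degree ?v"
    using viable_next_port[OF viable] .
  show ?thesis
  proof (cases "p \<in> P ?v ` adj ?F ?v")
    case True
    then obtain u where u: "{?v, u} \<in> ?F" "p = P ?v u" by auto
    then have "viable (h @ [(P ?v u, P u ?v, u, chain_degree u)]) P"
      using viable_snoc_traversed[OF viable refl] p(1) by simp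
    moreover have "forward_first ?F ?v u" using u(1) by (simp add: forward_first_def)
    ultimately show ?thesis using adversary_state_snoc[OF h] by blast
  next
    case False
    have F: "?F \<subseteq> chain_edges" "partial_ports chain_degree ?F P"
      using viable by (simp_all add: viable_def)
    obtain u where u: "{?v, u} \<in> chain_edges" "{?v, u} \<notin> ?F" "forward_first ?F ?v u"
      using ex_forward_first_edge[OF F(1) card_less_if_unused_port[OF F(2) p(2) False]] .
    have "no_full_band (insert {?v, u} ?F)"
      using h few viable_position[OF viable]
      by (intro no_full_band_insert) (auto simp: adversary_state_def)
    then obtain q P' where "viable (h @ [(p, q, u, chain_degree u)]) P'"
      using viable_snoc_new[OF viable refl u(1,2) _ p False] by blast
    then show ?thesis using adversary_state_snoc[OF h _ u(3)] by blast
  qed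
qed

lemma length_adversary_state_le:
  assumes "adversary_state h P"
  shows "length h \<le> card chain_edges + (\<Sum>x\<in>V. retraversals s h x)"
proof -
  have "traversed_edges s h \<subseteq> chain_edges" "set (visited_nodes s h) \<subseteq> V"
    using assms by (simp_all add: adversary_state_def viable_def)
  then show ?thesis
    using card_traversed_edges_plus_retraversals[OF finite_V, of s h]
      card_mono[OF finite_chain_edges, of "traversed_edges s h"] by simp
qed

lemma ex_adversary_state_many_retraversals:
  "\<exists>h P. adversary_state h P \<and> m * m \<le> (\<Sum>x\<in>V. retraversals s h x) + 2"
proof (rule ccontr)
  assume none: "\<not> ?thesis"
  have "\<exists>h P. adversary_state h P \<and> length h = n" for n
  proof (induction n)
    case 0
    then show ?case using adversary_state_Nil by (metis list.size(3))
  next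
    case (Suc n)
    then obtain h P where h: "adversary_state h P" "length h = n" by blast
    then have "(\<Sum>x\<in>V. retraversals s h x) + 2 < m * m" using none by (meson not_le)
    then show ?case
      using adversary_state_extends[OF h(1)] h(2) by (metis length_append_singleton)
  qed
  then obtain h P where h: "adversary_state h P" "length h = card chain_edges + m * m" by blast
  then have "m * m \<le> (\<Sum>x\<in>V. retraversals s h x) + 2"
    using length_adversary_state_le[OF h(1)] by simp
  then show False using none h(1) by blast
qed

lemma expensive_instance_exists:
  obtains G where "(G, s, \<alpha>) \<in> instances \<alpha> r" "card (verts G) = card V + (N + r - 3)"
    "int (m * m) - 2 \<le> penalty A G s"
proof -
  obtain h P where h: "viable h P" "m * m \<le> (\<Sum>x\<in>V. retraversals s h x) + 2"
    using ex_adversary_state_many_retraversals by (auto simp: adversary_state_def)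
  obtain G where G: "(G, s, \<alpha>) \<in> instances \<alpha> r" "valid_graph G" "s \<in> verts G"
    "\<not> edges G \<subseteq> traversed_edges s h" "card (verts G) = card V + (N + r - 3)"
    "execution A G s h (position s h)" "explores A G s"
    using viable_instance_exists[OF h(1)] .
  have "set (visited_nodes s h) \<subseteq> V" using h(1) by (simp add: viable_def)
  then have "int (\<Sum>x\<in>V. retraversals s h x) \<le> penalty A G s"
    by (rule retraversals_le_penalty[OF G(2,3,7,6,4) finite_V])
  then have "int (m * m) - 2 \<le> penalty A G s" using h(2) by linarith
  with G(1,5) show thesis by (rule that)
qed

end

section \<open>The lower bound\<close>

lemma layered_chain_exists:
  assumes "0 < m" "2 \<le> N"
  obtains V lay s where "layered_chain V lay s m N"
proof -
  define node where "node j i = int (prod_encode (j, i))" for j i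
  define lay where "lay x = fst (prod_decode (nat x))" for x
  define V where "V = insert (node 0 0) (case_prod node ` ({1..N} \<times> {..<m}))"
  have node [simp]: "lay (node j i) = j" "0 \<le> node j i" for j i
    by (simp_all add: lay_def node_def)
  have layer: "layering.layer V lay j = (if j = 0 then {node 0 0} else node j ` {..<m})"
    if "j \<le> N" for j
    using that by (auto simp: layering.layer_def V_def)
  have "card (node j ` {..<m}) = m" for j
    by (simp add: card_image inj_on_def node_def)
  then have "layered_chain V lay (node 0 0) m N"
    using assms by unfold_locales (auto simp: layer, auto simp: V_def)
  then show thesis by (rule that)
qed

lemma adversary_exists:
  assumes "solves A \<alpha> r" "6 \<le> r" "r \<le> D" "\<lfloor>(1 + \<alpha>) * real r\<rfloor> = int D" "0 < m"
  obtains V lay s where "adversary V lay s m (Suc D) A \<alpha> r"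
proof -
  obtain V lay s where "layered_chain V lay s m (Suc D)"
    using layered_chain_exists[of m "Suc D"] assms by auto
  moreover have "n < Suc D" if "real n \<le> (1 + \<alpha>) * real r" for n
    using that assms(4) by linarith
  ultimately have "adversary V lay s m (Suc D) A \<alpha> r"
    using assms by (simp add: adversary_def adversary_axioms_def)
  then show thesis by (rule that)
qed

lemma completion_size_bounds:
  fixes k D r :: nat
  assumes "2 \<le> k" "r \<le> D"
  shows "k \<le> Suc (k * Suc D) + (Suc D + r - 3)"
    "Suc (k * Suc D) + (Suc D + r - 3) \<le> k * (2 * D + 3)"
proof -
  have "2 * D \<le> k * D" using assms(1) by (rule mult_right_mono) simp
  moreover have "k * (2 * D + 3) = k * D + k * D + 3 * k" "k * Suc D = k * D + k"
    by (simp_all add: algebra_simps)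
  ultimately show "Suc (k * Suc D) + (Suc D + r - 3) \<le> k * (2 * D + 3)"
    "k \<le> Suc (k * Suc D) + (Suc D + r - 3)"
    using assms by linarith+
qed

lemma square_div_16_le:
  fixes n d k :: real
  assumes "2 \<le> k" "0 \<le> n" "0 < d" "n \<le> k * d"
  shows "(n / (16 * d))\<^sup>2 \<le> k * k - 2"
proof -
  have "n / (16 * d) \<le> k / 16" using assms by (simp add: field_simps)
  then have "(n / (16 * d))\<^sup>2 \<le> (k / 16)\<^sup>2" using assms by (intro power_mono) auto
  moreover have "2 * 2 \<le> k * k" using assms(1) by (intro mult_mono) auto
  ultimately show ?thesis by (simp add: power2_eq_square)
qed

theorem theorem1:
  fixes \<alpha> :: real and r :: nat and A :: algorithm
  assumes "\<alpha> > 0" and "r \<ge> 6"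
    and "solves A \<alpha> r"
  shows "\<forall>k::nat. k > 1 \<longrightarrow>
    (\<exists>G s. (G, s, \<alpha>) \<in> instances \<alpha> r \<and>
       card (verts G) \<ge> k \<and>
       real_of_int (penalty A G s) \<ge>
         (real (card (verts G)) /
           (16 * (2 * real_of_int \<lfloor>(1 + \<alpha>) * real r\<rfloor> + 3)))\<^sup>2)"
proof (intro allI impI)
  fix k :: nat assume k: "k > 1"
  define D where "D = nat \<lfloor>(1 + \<alpha>) * real r\<rfloor>"
  have "real r \<le> (1 + \<alpha>) * real r" using assms(1) by (simp add: distrib_right)
  then have D: "\<lfloor>(1 + \<alpha>) * real r\<rfloor> = int D" "r \<le> D" unfolding D_def by linarith+
  obtain V lay s where "adversary V lay s k (Suc D) A \<alpha> r"
    using adversary_exists[OF assms(3,2) D(2,1) order_less_trans[OF zero_less_one k]] .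
  then interpret adversary V lay s k "Suc D" A \<alpha> r .
  obtain G where G: "(G, s, \<alpha>) \<in> instances \<alpha> r"
    "card (verts G) = card V + (Suc D + r - 3)" "int (k * k) - 2 \<le> penalty A G s"
    using expensive_instance_exists .
  have size: "k \<le> card (verts G)" "card (verts G) \<le> k * (2 * D + 3)"
    using completion_size_bounds[of k r D] k D(2) by (simp_all add: G(2) card_V)
  have "(real (card (verts G)) / (16 * (2 * real D + 3)))\<^sup>2 \<le> real_of_int (int (k * k) - 2)"
    using square_div_16_le[of k "card (verts G)" "2 * real D + 3"] k
      of_nat_mono[OF size(2), where ?'a = real] by simp
  also have "\<dots> \<le> real_of_int (penalty A G s)" using G(3) by (simp only: of_int_le_iff)
  finally show "\<exists>G s. (G, s, \<alpha>) \<in> instances \<alpha> r \<and> card (verts G) \<ge> k \<and>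
      real_of_int (penalty A G s) \<ge>
        (real (card (verts G)) / (16 * (2 * real_of_int \<lfloor>(1 + \<alpha>) * real r\<rfloor> + 3)))\<^sup>2"
    using G(1) size(1) D(1) by auto
qed

end
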